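(* For $t\in\mathbb{Q}\setminus\{-1\}$ let $\phi_t(x)=\dfrac{x-t}{x^3+1}$. Let $\beta\in\mathbb{Q}(t)$ with $\deg(\beta)\geq3$. Then \[\limsup_{B\to\infty}\frac{\sum_{t\in\mathbb{Q}\setminus\{-1\},\,h(\beta(t))\leq B}\#\big(\mathcal{O}_{\phi_t}(\beta(t))\cap\mathbb{Z}\big)}{\#\{t\in\mathbb{Q}\setminus\{-1\}: h(\beta(t))\leq B\}}=0.\]
   Context: $\mathcal{O}_{\phi}(b)=\{b,\phi(b),\phi^2(b),\dots\}$ is the forward orbit in $\mathbb{P}^1(\mathbb{Q})$, and $\mathcal{O}_\phi(b)\cap\mathbb{Z}$ is the set of orbit points that are integers. $h$ is the logarithmic Weil height on $\mathbb{P}^1(\mathbb{Q})$. (Here the parameter set $\mathbb{Q}\setminus\{-1\}=\mathbb{P}^1(\mathbb{Q})\setminus\{-1,\infty\}$ is exactly the set of $t$ for which $\phi_t$ is a degree-3 rational map whose second iterate is not a polynomial.) *)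

theory Defs
  imports "HOL-Analysis.Analysis" "HOL-Computational_Algebra.Computational_Algebra"
    "HOL-Computational_Algebra.Field_as_Ring"
begin

datatype P1Q = Aff rat | Infty

text \<open>
  Elements of \<open>rat poly fract\<close> are the rational functions in one variable over the rationals;
  \<^const>\<open>quot_of_fract\<close> yields their representation in lowest terms with monic denominator.
\<close>

definition ratfun_degree :: "rat poly fract \<Rightarrow> nat" where
  "ratfun_degree f = max (degree (fst (quot_of_fract f))) (degree (snd (quot_of_fract f)))"

text \<open>
  The induced map on the projective line. At infinity, \<open>p / q\<close> in lowest terms of degree \<open>n\<close>
  takes the value \<open>[coeff p n : coeff q n]\<close> (homogenize in degree \<open>n\<close> and evaluate at \<open>[1 : 0]\<close>).
\<close>

fun ratfun_eval :: "rat poly fract \<Rightarrow> P1Q \<Rightarrow> P1Q" where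
  "ratfun_eval f (Aff x) =
     (let (p, q) = quot_of_fract f
      in if poly q x = 0 then Infty else Aff (poly p x / poly q x))"
| "ratfun_eval f Infty =
     (let (p, q) = quot_of_fract f; n = ratfun_degree f
      in if coeff q n = 0 then Infty else Aff (coeff p n / coeff q n))"

text \<open>
  Since \<^const>\<open>quotient_of\<close> returns the fraction in lowest terms, this is
  \<open>ln (max \<bar>a\<bar> \<bar>b\<bar>)\<close> for coprime homogeneous integer coordinates \<open>[a : b]\<close>;
  the point at infinity is \<open>[1 : 0]\<close>.
\<close>

fun weil_height :: "P1Q \<Rightarrow> real" where
  "weil_height (Aff x) = (let (a, b) = quotient_of x in ln (real_of_int (max \<bar>a\<bar> \<bar>b\<bar>)))"
| "weil_height Infty = 0"

definition forward_orbit :: "('a \<Rightarrow> 'a) \<Rightarrow> 'a \<Rightarrow> 'a set" where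
  "forward_orbit f b = range (\<lambda>n. (f ^^ n) b)"

definition integer_points :: "P1Q set" where
  "integer_points = Aff ` \<int>"

definition phi :: "rat \<Rightarrow> rat poly fract" where
  "phi t = to_fract [:- t, 1:] / to_fract [:1, 0, 0, 1:]"

definition params :: "rat poly fract \<Rightarrow> real \<Rightarrow> rat set" where
  "params \<beta> B = {t. t \<noteq> - 1 \<and> weil_height (ratfun_eval \<beta> (Aff t)) \<le> B}"

lemma no_rat_root:
  fixes x :: rat
  shows "x ^ 3 + 1 = 0 \<longleftrightarrow> x = -1"
proof -
  have "x ^ 3 + 1 = (x + 1) * ((x - 1/2) ^ 2 + 3/4)"
    by (simp add: power2_eq_square power3_eq_cube field_simps)
  moreover have "(x - 1/2) ^ 2 + 3/4 > 0" by (simp add: add_nonneg_pos)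
  ultimately show ?thesis by (auto simp: add_eq_0_iff)
qed

lemma quot_of_fract_phi:
  assumes "t \<noteq> -1"
  shows "quot_of_fract (phi t) = ([:- t, 1:], [:1, 0, 0, 1:])"
proof -
  have "coprime [:- t, 1:] [:1, 0, 0, 1:]"
  proof (rule prime_elem_imp_coprime)
    show "prime_elem [:- t, 1:]"
      by (rule prime_elem_linear_field_poly) simp
    show "\<not> [:- t, 1:] dvd [:1, 0, 0, 1:]"
    proof
      assume "[:- t, 1:] dvd [:1, 0, 0, 1:]"
      hence "poly [:1, 0, 0, 1:] t = 0" by (subst poly_eq_0_iff_dvd)
      hence "t ^ 3 + 1 = 0" by (simp add: power3_eq_cube algebra_simps)
      with assms show False using no_rat_root by blast
    qed
  qed
  hence "([:- t, 1:], [:1, 0, 0, 1:]) \<in> normalized_fracts"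
    by (simp add: normalized_fracts_def unit_factor_poly_def one_pCons)
  hence "quot_of_fract (quot_to_fract ([:- t, 1:], [:1, 0, 0, 1:])) = ([:- t, 1:], [:1, 0, 0, 1:])"
    by (rule quot_of_fract_quot_to_fract')
  thus ?thesis
    by (simp add: phi_def quot_to_fract_def to_fract_def)
qed

lemma ratfun_degree_phi: "t \<noteq> -1 \<Longrightarrow> ratfun_degree (phi t) = 3"
  by (simp add: ratfun_degree_def quot_of_fract_phi)

lemma ratfun_eval_phi_Aff:
  "t \<noteq> -1 \<Longrightarrow>
     ratfun_eval (phi t) (Aff x) = (if x = -1 then Infty else Aff ((x - t) / (x ^ 3 + 1)))"
  using no_rat_root[of x] by (auto simp: quot_of_fract_phi power3_eq_cube algebra_simps)

lemma ratfun_eval_phi_Infty: "t \<noteq> -1 \<Longrightarrow> ratfun_eval (phi t) Infty = Aff 0"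
  by (simp add: quot_of_fract_phi ratfun_degree_phi numeral_3_eq_3)

lemma finite_weil_height_le: "finite {x. weil_height x \<le> B}"
proof (rule finite_subset)
  let ?N = "\<lceil>exp B\<rceil>"
  let ?S = "{- ?N..?N}"
  show "{x. weil_height x \<le> B} \<subseteq>
          insert Infty ((\<lambda>(a, b). Aff (of_int a / of_int b)) ` (?S \<times> ?S))"
  proof
    fix x assume "x \<in> {x. weil_height x \<le> B}"
    hence h: "weil_height x \<le> B" by simp
    show "x \<in> insert Infty ((\<lambda>(a, b). Aff (of_int a / of_int b)) ` (?S \<times> ?S))"
    proof (cases x)
      case (Aff r)
      obtain a b where ab: "quotient_of r = (a, b)" by fastforce
      have b: "b > 0" using ab by (rule quotient_of_denom_pos)
      have r: "r = of_int a / of_int b" using ab by (rule quotient_of_div)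
      have "ln (real_of_int (max \<bar>a\<bar> \<bar>b\<bar>)) \<le> B" using h by (simp add: Aff ab)
      moreover have "real_of_int (max \<bar>a\<bar> \<bar>b\<bar>) > 0" using b by (simp add: less_max_iff_disj)
      ultimately have "real_of_int (max \<bar>a\<bar> \<bar>b\<bar>) \<le> exp B"
        by (metis exp_le_cancel_iff exp_ln)
      hence "max \<bar>a\<bar> \<bar>b\<bar> \<le> ?N" by linarith
      hence "(a, b) \<in> ?S \<times> ?S" by auto
      thus ?thesis unfolding Aff r by (intro insertI2 rev_image_eqI[of "(a, b)"]) auto
    qed auto
  qed
qed auto

lemma finite_ratfun_fibre:
  assumes "ratfun_degree f > 0"
  shows "finite {t. ratfun_eval f (Aff t) = y}"
proof -
  obtain p q where pq: "quot_of_fract f = (p, q)" by fastforce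
  have q0: "q \<noteq> 0" using snd_quot_of_fract_nonzero[of f] pq by simp
  have cop: "coprime p q" using coprime_quot_of_fract[of f] pq by simp
  have deg: "max (degree p) (degree q) > 0" using assms pq by (simp add: ratfun_degree_def)
  show ?thesis
  proof (cases y)
    case (Aff c)
    have "p - smult c q \<noteq> 0"
    proof
      assume "p - smult c q = 0"
      hence p: "p = smult c q" by simp
      hence "q dvd p" by (simp add: dvd_smult)
      with cop have "is_unit q" by (meson coprime_common_divisor dvd_refl)
      hence "degree q = 0" using is_unit_iff_degree[OF q0] by blast
      with p deg show False by (simp split: if_splits)
    qed
    hence "finite {t. poly (p - smult c q) t = 0}" by (rule poly_roots_finite)
    moreover have "{t. ratfun_eval f (Aff t) = y} \<subseteq> {t. poly (p - smult c q) t = 0}"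
      by (auto simp: pq Aff split: if_splits)
    ultimately show ?thesis by (rule rev_finite_subset)
  next
    case Infty
    have "{t. ratfun_eval f (Aff t) = y} \<subseteq> {t. poly q t = 0}"
      by (auto simp: pq Infty split: if_splits)
    thus ?thesis using poly_roots_finite[OF q0] by (rule finite_subset)
  qed
qed

text \<open>Hence the sum and the cardinality taken over \<^const>\<open>params\<close> range over a finite set.\<close>

lemma finite_params:
  assumes "ratfun_degree \<beta> > 0"
  shows "finite (params \<beta> B)"
proof (rule finite_subset)
  show "params \<beta> B \<subseteq> (\<Union>y\<in>{y. weil_height y \<le> B}. {t. ratfun_eval \<beta> (Aff t) = y})"
    by (auto simp: params_def simp del: ratfun_eval.simps)
qed (use finite_weil_height_le finite_ratfun_fibre[OF assms] in auto)

end

theory Submission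
  imports Defs
begin

text \<open>
  Let $H$ be the multiplicative height and $t = u/v$. If $\phi_t(a/b)$ is an integer, then $a^3+b^3$
  divides $u^3+v^3$; as $a^2-ab+b^2$ is positive definite this gives $3 H(a/b)^2 \le 8 H(t)^3$, so
  every orbit contains only finitely many integers. On the other hand
  $3 H(x)^3 \le 32 H(t)^4 H(\phi_t(x))$, so the condition $H(x) \ge 4 H(t)^2$ is inherited by
  $\phi_t(x)$ and excludes that $\phi_t(x)$ is an integer. Since $H(\beta(t))$ is of order $H(t)^d$ with
  $d \ge 3$, for all but finitely many $t$ the only possible integer in the orbit is
  $\beta(t)$ itself. The number of $t$ with $H(t) \le n$ and $\beta(t)$ an integer is $O(n)$, whereas
  the number of all $t$ with $H(t) \le n$ grows faster than linearly.
\<close>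

section \<open>Heights and the map $\phi_t$\<close>

text \<open>Reduced coordinates of t and x present phi_t(x) as a quotient of two cubic forms in the
  coordinates of x, and everything turns on how much can cancel in it. Cancellation is controlled by
  the resultant t^3 + 1 of x - t and x^3 + 1, whose only rational zero is t = -1, so the loss
  depends on t alone. With a cubic gain in H(x) against a loss of H(t)^4, a condition H(x) >= A
  H(t)^e reproduces itself by this estimate only if 3e - 4 >= e, that is e >= 2; for e = 2 the least
  integer A that works is 4. A degree d >= 3 lies strictly above this exponent, so the unknown
  constant in H(\<beta>(t)) >= c H(t)^d is absorbed once H(t) is large. The parameters are ordered
  by H(\<beta>(t)), the counts by H(t). Two-sided bounds with the same exponent d place the
  parameters, up to finitely many, between two height balls whose radii have bounded ratio. Hence a
  linear upper bound against any superlinear lower bound decides the limit, and no asymptotic count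
  of rationals is required.\<close>

definition rat_height :: "rat \<Rightarrow> int" where
  "rat_height x = max \<bar>fst (quotient_of x)\<bar> \<bar>snd (quotient_of x)\<bar>"

lemma weil_height_Aff: "weil_height (Aff x) = ln (real_of_int (rat_height x))"
  by (simp add: rat_height_def split: prod.split)

lemma rat_height_ge_1: "rat_height x \<ge> 1"
  using quotient_of_denom_pos'[of x] by (simp add: rat_height_def)

lemma finite_rat_height_le: "finite {x. rat_height x \<le> n}"
proof (rule finite_subset)
  show "{x. rat_height x \<le> n} \<subseteq> Aff -` {x. weil_height x \<le> ln (real_of_int n)}"
    using rat_height_ge_1 by (auto simp: weil_height_Aff simp del: weil_height.simps)
      (smt (verit, best) ln_le_cancel_iff of_int_0_less_iff of_int_le_iff)
  show "finite (Aff -` {x. weil_height x \<le> ln (real_of_int n)})"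
    by (intro finite_vimageI finite_weil_height_le) (simp add: inj_on_def)
qed

lemma quotient_of_eqI:
  assumes "coprime a b" "b > 0"
  shows "quotient_of (of_int a / of_int b) = (a, b)"
  using assms by (metis Fract_of_int_quotient normalize_stable quotient_of_Fract)

text \<open>The gcd is exactly the factor by which reduction to lowest terms shrinks the pair. The
  height bounds below all treat an unreduced fraction and control this gcd.\<close>

lemma rat_height_of_int_divide:
  assumes "b \<noteq> 0"
  shows "gcd a b * rat_height (of_int a / of_int b) = max \<bar>a\<bar> \<bar>b\<bar>"
proof -
  \<comment> \<open>The sign of \<open>b\<close> makes the reduced denominator positive, as
    \<open>quotient_of\<close> requires.\<close>
  define g where "g = gcd a b * sgn b"
  define a' b' where "a' = a div g" and "b' = b div g"
  have "g dvd a" "g dvd b" using assms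
    by (auto simp: g_def sgn_if)
  hence ab: "a = a' * g" "b = b' * g" by (simp_all add: a'_def b'_def)
  have absg: "\<bar>g\<bar> = gcd a b" using assms by (simp add: g_def abs_mult sgn_if)
  have g0: "g \<noteq> 0" using assms ab by auto
  have "gcd a b = \<bar>g\<bar> * gcd a' b'"
    unfolding gcd_mult_distrib_int by (simp only: ab(1)[symmetric] ab(2)[symmetric] mult.commute[of g])
  hence "coprime a' b'" using absg g0 assms by (simp add: coprime_iff_gcd_eq_1)
  moreover have "b' > 0"
  proof -
    have "b' * \<bar>g\<bar> = \<bar>b\<bar>" using ab(2) assms absg by (cases "b > 0") (auto simp: g_def abs_if sgn_if split: if_splits)
    thus ?thesis using assms g0 by (metis abs_ge_zero mult_nonpos_nonneg not_le zero_less_abs_iff)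
  qed
  ultimately have "quotient_of (of_int a' / of_int b') = (a', b')" by (rule quotient_of_eqI)
  moreover have "(of_int a / of_int b :: rat) = of_int a' / of_int b'"
    using g0 by (subst ab(1), subst ab(2)) simp
  ultimately have "rat_height (of_int a / of_int b) = max \<bar>a'\<bar> \<bar>b'\<bar>"
    by (simp add: rat_height_def)
  thus ?thesis unfolding absg[symmetric]
    by (subst (2) ab(1), subst (2) ab(2)) (simp add: abs_mult max_mult_distrib_right mult.commute[of "\<bar>g\<bar>"])
qed

section \<open>Size and common divisors of the binary forms behind \<open>phi\<close>\<close>

lemma eisenstein_form_lower:
  fixes a b :: int
  shows "3 * (max \<bar>a\<bar> \<bar>b\<bar>)\<^sup>2 \<le> 4 * (a\<^sup>2 - a * b + b\<^sup>2)"
proof -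
  have "4 * (a\<^sup>2 - a * b + b\<^sup>2) = (2 * a - b)\<^sup>2 + 3 * b\<^sup>2"
    "4 * (a\<^sup>2 - a * b + b\<^sup>2) = (2 * b - a)\<^sup>2 + 3 * a\<^sup>2"
    by (auto simp: power2_eq_square algebra_simps)
  moreover have "(2 * a - b)\<^sup>2 \<ge> 0" "(2 * b - a)\<^sup>2 \<ge> 0" by auto
  ultimately show ?thesis by (simp add: max_def)
qed

lemma sum_cubes_factor:
  fixes a b :: int
  shows "a ^ 3 + b ^ 3 = (a + b) * (a\<^sup>2 - a * b + b\<^sup>2)"
  by (simp add: power2_eq_square power3_eq_cube algebra_simps)

text \<open>The nonzero integer a + b has absolute value at least 1, so the quadratic factor, the
  norm form of the Eisenstein integers, carries the bound. The exponent is 2 and not 3 because along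
  a + b = 1 the sum of cubes grows only quadratically.\<close>

lemma sum_cubes_lower:
  fixes a b :: int
  assumes "a + b \<noteq> 0"
  shows "3 * (max \<bar>a\<bar> \<bar>b\<bar>)\<^sup>2 \<le> 4 * \<bar>a ^ 3 + b ^ 3\<bar>"
proof -
  let ?F = "a\<^sup>2 - a * b + b\<^sup>2"
  have F: "3 * (max \<bar>a\<bar> \<bar>b\<bar>)\<^sup>2 \<le> 4 * ?F" by (rule eisenstein_form_lower)
  have "0 \<le> 3 * (max \<bar>a\<bar> \<bar>b\<bar>)\<^sup>2" by simp
  with F have "0 \<le> 4 * ?F" by (rule order_trans[rotated])
  hence "?F \<ge> 0" by simp
  moreover have "\<bar>a + b\<bar> \<ge> 1" using assms by linarith
  ultimately have "1 * ?F \<le> \<bar>a + b\<bar> * ?F" by (intro mult_right_mono)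
  also have "\<dots> = \<bar>a ^ 3 + b ^ 3\<bar>" using \<open>?F \<ge> 0\<close> by (simp add: sum_cubes_factor abs_mult)
  finally have "?F \<le> \<bar>a ^ 3 + b ^ 3\<bar>" by simp
  with F show ?thesis by (meson mult_left_mono order_trans zero_le_numeral)
qed

text \<open>The two forms have no common nontrivial real zero: a^3 + b^3 is small only for a/b near
  -1, and there a v - u b is close to -b (u + v), where u + v is a nonzero integer. The case split
  measures nearness to -1 by comparing |a + b| v with M/4.\<close>

lemma phi_forms_lower:
  fixes a b u v :: int
  assumes v: "v \<ge> 1" and uv: "u + v \<noteq> 0"
  shows "3 * (max \<bar>a\<bar> \<bar>b\<bar>) ^ 3 \<le> 16 * max \<bar>b\<^sup>2 * (a * v - u * b)\<bar> \<bar>v * (a ^ 3 + b ^ 3)\<bar>"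
proof -
  define M where "M = max \<bar>a\<bar> \<bar>b\<bar>"
  define s where "s = \<bar>a + b\<bar>"
  define F where "F = a\<^sup>2 - a * b + b\<^sup>2"
  have M0: "M \<ge> 0" by (simp add: M_def)
  have F: "3 * M\<^sup>2 \<le> 4 * F" unfolding F_def M_def by (rule eisenstein_form_lower)
  have F0: "F \<ge> 0" using F zero_le_power2[of M] by linarith
  have s0: "s \<ge> 0" by (simp add: s_def)
  have ssv: "s \<le> s * v" using mult_left_mono[OF v s0] by simp
  show ?thesis
  proof (cases "M \<le> 4 * (s * v)")
    case True
    have "M * (3 * M\<^sup>2) \<le> (4 * (s * v)) * (4 * F)"
      by (rule mult_mono[OF True F]) (use M0 True in auto)
    also have "\<dots> = 16 * \<bar>v * (a ^ 3 + b ^ 3)\<bar>"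
      using v F0 by (simp add: sum_cubes_factor abs_mult s_def F_def)
    finally show ?thesis by (simp add: M_def[symmetric] power2_eq_square power3_eq_cube)
  next
    case False
    \<comment> \<open>Now |a + b| < M/4, which leaves |b| at least 3M/4.\<close>
    have b: "3 * M \<le> 4 * \<bar>b\<bar>"
      using False ssv M0 unfolding M_def s_def by (auto simp: max_def split: if_splits)
    have "\<bar>b\<bar> * 1 \<le> \<bar>b\<bar> * \<bar>u + v\<bar>" using uv by (intro mult_left_mono) auto
    hence 1: "\<bar>b\<bar> \<le> \<bar>b * (u + v)\<bar>" by (simp add: abs_mult)
    have 2: "a * v - u * b = (a + b) * v - b * (u + v)" by (simp add: algebra_simps)
    have 3: "\<bar>(a + b) * v\<bar> = s * v" using v by (simp add: s_def abs_mult)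
    \<comment> \<open>Reverse triangle inequality: 3M/4 - M/4 = M/2.\<close>
    have "2 * M \<le> 4 * \<bar>X - Y\<bar>" if "\<bar>b\<bar> \<le> \<bar>Y\<bar>" "\<bar>X\<bar> = s * v" for X Y
      using that b False by (smt (verit))
    hence "2 * M \<le> 4 * \<bar>a * v - u * b\<bar>" unfolding 2 using 1 3 by blast
    moreover have "(3 * M)\<^sup>2 \<le> (4 * \<bar>b\<bar>)\<^sup>2" using b M0 by (intro power_mono) auto
    ultimately have "(3 * M)\<^sup>2 * (2 * M) \<le> (4 * \<bar>b\<bar>)\<^sup>2 * (4 * \<bar>a * v - u * b\<bar>)"
      by (intro mult_mono[where c = "2 * M"]) (use M0 in auto)
    hence "18 * M ^ 3 \<le> 64 * \<bar>b\<^sup>2 * (a * v - u * b)\<bar>"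
      by (simp add: power2_eq_square power3_eq_cube abs_mult mult.assoc)
    moreover have "M ^ 3 \<ge> 0" using M0 by simp
    ultimately show ?thesis unfolding M_def[symmetric] by linarith
  qed
qed

text \<open>The number u^3 + v^3 is the resultant of x - t and x^3 + 1 in homogeneous form. As a and
  b are coprime, the gcd is coprime to b, so powers of b may be cancelled: first from the left form,
  then from the identity that writes b^3 (u^3 + v^3) in terms of a^3 + b^3 and a v - u b.\<close>

lemma gcd_phi_forms_dvd:
  fixes a b u v :: int
  assumes ab: "coprime a b"
  shows "gcd (b\<^sup>2 * (a * v - u * b)) (a ^ 3 + b ^ 3) dvd u ^ 3 + v ^ 3"
proof -
  let ?m = "a ^ 3 + b ^ 3"
  let ?g = "gcd (b\<^sup>2 * (a * v - u * b)) ?m"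
  have "coprime (a ^ 3) b" using ab by simp
  hence "coprime ?m b"
    by (metis (no_types) coprime_iff_gcd_eq_1 gcd_add_mult gcd.commute add.commute power3_eq_cube mult.assoc)
  hence cop: "coprime ?g b" using coprime_divisors[of ?g ?m b b] by simp
  have "?g dvd b\<^sup>2 * (a * v - u * b)" by simp
  hence *: "?g dvd a * v - u * b" using cop
    by (simp add: coprime_dvd_mult_right_iff del: gcd_dvd1)
  have "b ^ 3 * (u ^ 3 + v ^ 3) = ?m * v ^ 3 -
      (a * v - u * b) * ((a * v)\<^sup>2 + (a * v) * (u * b) + (u * b)\<^sup>2)"
    by (simp add: power2_eq_square power3_eq_cube algebra_simps)
  moreover have "?g dvd ?m * v ^ 3"
    "?g dvd (a * v - u * b) * ((a * v)\<^sup>2 + (a * v) * (u * b) + (u * b)\<^sup>2)"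
    using * by (blast intro: dvd_mult2 gcd_dvd2)+
  ultimately have "?g dvd b ^ 3 * (u ^ 3 + v ^ 3)" by (simp only: dvd_diff)
  thus ?thesis using cop by (simp add: coprime_dvd_mult_right_iff)
qed

lemma phi_eq_forms:
  fixes t x :: rat
  assumes "quotient_of t = (u, v)" "quotient_of x = (a, b)"
  shows "(x - t) / (x ^ 3 + 1) = of_int (b\<^sup>2 * (a * v - u * b)) / of_int (v * (a ^ 3 + b ^ 3))"
proof -
  have t: "t = of_int u / of_int v" "v > 0" and x: "x = of_int a / of_int b" "b > 0"
    using assms quotient_of_div quotient_of_denom_pos by blast+
  have "x ^ 3 + 1 = (of_int (a ^ 3 + b ^ 3)) / of_int b ^ 3"
    using x(2) unfolding x(1) by (simp add: field_simps power_divide)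
  moreover have "x - t = of_int (a * v - u * b) / (of_int b * of_int v)"
    using x(2) t(2) unfolding x(1) t(1) by (simp add: field_simps)
  ultimately show ?thesis using x(2) t(2)
    by (simp add: power2_eq_square power3_eq_cube)
qed

section \<open>Height growth and integrality under \<open>phi\<close>\<close>

lemma sum_quotient_of_nonzero:
  assumes "quotient_of t = (u, v)" "t \<noteq> -1"
  shows "u + v \<noteq> 0"
proof
  assume "u + v = 0"
  hence "u = - v" by simp
  moreover have "t = of_int u / of_int v" "v > 0"
    using assms quotient_of_div quotient_of_denom_pos by blast+
  ultimately show False using assms(2) by simp
qed

lemma sum_cubes_nonzero:
  fixes u v :: int
  assumes "u + v \<noteq> 0"
  shows "u ^ 3 + v ^ 3 \<noteq> 0"
proof
  assume "u ^ 3 + v ^ 3 = 0"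
  with sum_cubes_lower[OF assms] have "(max \<bar>u\<bar> \<bar>v\<bar>)\<^sup>2 \<le> 0" by simp
  hence "max \<bar>u\<bar> \<bar>v\<bar> = 0" by simp
  thus False using assms by (auto simp: max_def split: if_splits)
qed

lemma sum_cubes_upper:
  fixes u v :: int
  assumes "quotient_of t = (u, v)"
  shows "\<bar>u ^ 3 + v ^ 3\<bar> \<le> 2 * rat_height t ^ 3"
proof -
  have "\<bar>u\<bar> ^ 3 \<le> rat_height t ^ 3" "\<bar>v\<bar> ^ 3 \<le> rat_height t ^ 3"
    by (intro power_mono; simp add: rat_height_def assms)+
  thus ?thesis using abs_triangle_ineq[of "u ^ 3" "v ^ 3"] by (simp add: power_abs)
qed

text \<open>The gcd of numerator and denominator divides v (u^3 + v^3), where the extra v comes from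
  the denominator v (a^3 + b^3). So reduction costs at most 2 H(t)^4, and with the 16 of
  \<open>phi_forms_lower\<close> this makes 32.\<close>

lemma rat_height_phi_lower:
  assumes t: "t \<noteq> -1" and x: "x \<noteq> -1"
  shows "3 * rat_height x ^ 3 \<le> 32 * rat_height t ^ 4 * rat_height ((x - t) / (x ^ 3 + 1))"
proof -
  obtain u v where uv: "quotient_of t = (u, v)" by fastforce
  obtain a b where ab: "quotient_of x = (a, b)" by fastforce
  note nz = sum_quotient_of_nonzero[OF uv t] sum_quotient_of_nonzero[OF ab x]
  have v: "v > 0" using uv by (rule quotient_of_denom_pos)
  have cop: "coprime a b" using ab by (rule quotient_of_coprime)
  let ?A = "b\<^sup>2 * (a * v - u * b)" and ?m = "a ^ 3 + b ^ 3"
  let ?g = "gcd ?A (v * ?m)" and ?h = "rat_height ((x - t) / (x ^ 3 + 1))"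
  have "v * gcd ?A ?m = gcd (v * ?A) (v * ?m)" using gcd_mult_distrib_int[of v ?A ?m] v by simp
  hence "?g dvd v * gcd ?A ?m" by (metis dvd_mult gcd_dvd1 gcd_dvd2 gcd_greatest)
  also have "\<dots> dvd v * (u ^ 3 + v ^ 3)"
    by (intro mult_dvd_mono dvd_refl gcd_phi_forms_dvd cop)
  finally have "?g \<le> \<bar>v * (u ^ 3 + v ^ 3)\<bar>"
    using sum_cubes_nonzero[OF nz(1)] v by (intro zdvd_imp_le) auto
  also have "\<dots> = \<bar>v\<bar> * \<bar>u ^ 3 + v ^ 3\<bar>" by (simp add: abs_mult)
  also have "\<dots> \<le> rat_height t * (2 * rat_height t ^ 3)"
    using uv rat_height_ge_1[of t]
    by (intro mult_mono sum_cubes_upper) (auto simp: rat_height_def)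
  finally have g: "?g \<le> 2 * rat_height t ^ 4" by (simp add: power_numeral_reduce)
  have "3 * rat_height x ^ 3 \<le> 16 * max \<bar>?A\<bar> \<bar>v * ?m\<bar>"
    using phi_forms_lower[of v u a b] v nz by (simp add: rat_height_def ab)
  also have "max \<bar>?A\<bar> \<bar>v * ?m\<bar> = ?g * ?h"
    using rat_height_of_int_divide[of "v * ?m" ?A] v sum_cubes_nonzero[OF nz(2)]
    by (simp only: phi_eq_forms[OF uv ab]) simp
  also have "16 * (?g * ?h) \<le> 16 * (2 * rat_height t ^ 4 * ?h)"
    using g rat_height_ge_1[of "(x - t) / (x ^ 3 + 1)"] by (intro mult_left_mono mult_right_mono) auto
  finally show ?thesis by simp
qed

text \<open>Integrality makes the denominator divide the numerator, so a^3 + b^3 is itself a common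
  divisor of the kind bounded by \<open>gcd_phi_forms_dvd\<close>. The 8 is the 4 of
  \<open>sum_cubes_lower\<close> times the 2 of \<open>sum_cubes_upper\<close>.\<close>

lemma rat_height_le_of_phi_integer:
  assumes t: "t \<noteq> -1" and x: "x \<noteq> -1" and int: "(x - t) / (x ^ 3 + 1) \<in> \<int>"
  shows "3 * (rat_height x)\<^sup>2 \<le> 8 * rat_height t ^ 3"
proof -
  obtain u v where uv: "quotient_of t = (u, v)" by fastforce
  obtain a b where ab: "quotient_of x = (a, b)" by fastforce
  note nz = sum_quotient_of_nonzero[OF uv t] sum_quotient_of_nonzero[OF ab x]
  have v: "v > 0" using uv by (rule quotient_of_denom_pos)
  have cop: "coprime a b" using ab by (rule quotient_of_coprime)
  let ?A = "b\<^sup>2 * (a * v - u * b)" and ?m = "a ^ 3 + b ^ 3"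
  from int obtain k where "(x - t) / (x ^ 3 + 1) = of_int k" by (auto elim: Ints_cases)
  moreover have "(of_int (v * ?m) :: rat) \<noteq> 0"
    using v sum_cubes_nonzero[OF nz(2)] by (subst of_int_eq_0_iff) auto
  ultimately have "(of_int ?A :: rat) = of_int (k * (v * ?m))"
    unfolding phi_eq_forms[OF uv ab] by (subst (asm) nonzero_divide_eq_eq) (assumption, simp only: of_int_mult)
  hence "?A = k * (v * ?m)" by (simp only: of_int_eq_iff)
  hence "?m dvd gcd ?A ?m" by simp
  also have "\<dots> dvd u ^ 3 + v ^ 3" by (rule gcd_phi_forms_dvd[OF cop])
  finally have "\<bar>?m\<bar> \<le> \<bar>u ^ 3 + v ^ 3\<bar>"
    using sum_cubes_nonzero[OF nz(1)] by (intro dvd_imp_le_int) auto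
  also have "\<dots> \<le> 2 * rat_height t ^ 3" by (rule sum_cubes_upper[OF uv])
  finally show ?thesis using sum_cubes_lower[OF nz(2)] by (simp add: rat_height_def ab)
qed

lemma rat_height_minus_one: "rat_height (-1) = 1"
  using quotient_of_eqI[of "-1" 1] by (simp add: rat_height_def)

text \<open>An integer other than the start has a predecessor in the orbit, which is infinity or a
  rational of bounded height. This is for the finitely many t that
  \<open>integer_orbit_subset\<close> does not reach: they cannot just be dropped, since one
  infinite \<open>emeasure\<close> would spoil the whole sum.\<close>

lemma finite_integer_orbit:
  assumes t: "t \<noteq> -1"
  shows "finite (forward_orbit (ratfun_eval (phi t)) b \<inter> integer_points)"
proof (rule finite_subset)
  let ?f = "ratfun_eval (phi t)"
  let ?S = "{x. rat_height x \<le> 8 * rat_height t ^ 3}"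
  show "forward_orbit ?f b \<inter> integer_points \<subseteq> insert b (insert (?f Infty) (?f ` Aff ` ?S))"
  proof
    fix y assume y: "y \<in> forward_orbit ?f b \<inter> integer_points"
    then obtain n where n: "y = (?f ^^ n) b" by (auto simp: forward_orbit_def)
    show "y \<in> insert b (insert (?f Infty) (?f ` Aff ` ?S))"
    proof (cases n)
      case (Suc k)
      hence yk: "y = ?f ((?f ^^ k) b)" using n by simp
      show ?thesis
      proof (cases "(?f ^^ k) b")
        case (Aff x)
        with yk y have "x \<noteq> -1 \<and> (x - t) / (x ^ 3 + 1) \<in> \<int>"
          by (auto simp: ratfun_eval_phi_Aff[OF t] integer_points_def
                simp del: ratfun_eval.simps split: if_splits)
        hence "3 * (rat_height x)\<^sup>2 \<le> 8 * rat_height t ^ 3"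
          using rat_height_le_of_phi_integer[OF t] by blast
        moreover have "rat_height x \<le> (rat_height x)\<^sup>2"
          using rat_height_ge_1[of x] by (simp add: self_le_power)
        ultimately have "rat_height x \<le> 8 * rat_height t ^ 3"
          using rat_height_ge_1[of x] by linarith
        thus ?thesis using yk Aff by (auto simp del: ratfun_eval.simps)
      qed (use yk in \<open>auto simp del: ratfun_eval.simps\<close>)
    qed (use n in auto)
  qed
qed (use finite_rat_height_le in auto)

text \<open>Put h = H(t). From 3 (4 h^2)^3 = 32 h^4 * 6 h^2 the image has height at least 6 h^2,
  while an integral image would force 48 h^4 <= 8 h^3. As 4 h^2 > 1 = H(-1), the orbit avoids the
  pole -1 and stays affine.\<close>

lemma integer_orbit_subset:
  assumes t: "t \<noteq> -1" and x: "rat_height x \<ge> 4 * (rat_height t)\<^sup>2"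
  shows "forward_orbit (ratfun_eval (phi t)) (Aff x) \<inter> integer_points \<subseteq> {Aff x}"
proof -
  let ?f = "ratfun_eval (phi t)"
  let ?h = "rat_height t"
  have h: "?h \<ge> 1" by (rule rat_height_ge_1)
  have step: "?f (Aff y) = Aff ((y - t) / (y ^ 3 + 1)) \<and> rat_height ((y - t) / (y ^ 3 + 1)) \<ge> 4 * ?h\<^sup>2
      \<and> (y - t) / (y ^ 3 + 1) \<notin> \<int>" if y: "rat_height y \<ge> 4 * ?h\<^sup>2" for y
  proof -
    have h2: "?h\<^sup>2 \<ge> 1" using h by simp
    hence y1: "y \<noteq> -1" using y by (auto simp: rat_height_minus_one)
    have "3 * (4 * ?h\<^sup>2) ^ 3 \<le> 3 * rat_height y ^ 3"
      using y h by (intro mult_left_mono power_mono) auto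
    also note rat_height_phi_lower[OF t y1]
    finally have "(32 * ?h ^ 4) * (6 * ?h\<^sup>2) \<le> (32 * ?h ^ 4) * rat_height ((y - t) / (y ^ 3 + 1))"
      by (simp add: power_mult_distrib power_mult[symmetric] power_add[symmetric])
    hence "6 * ?h\<^sup>2 \<le> rat_height ((y - t) / (y ^ 3 + 1))"
      using h by (subst (asm) mult_le_cancel_left_pos) auto
    hence 1: "4 * ?h\<^sup>2 \<le> rat_height ((y - t) / (y ^ 3 + 1))" using h2 by linarith
    have "(y - t) / (y ^ 3 + 1) \<notin> \<int>"
    proof
      assume "(y - t) / (y ^ 3 + 1) \<in> \<int>"
      from rat_height_le_of_phi_integer[OF t y1 this]
      have "3 * (rat_height y)\<^sup>2 \<le> 8 * ?h ^ 3" .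
      moreover have "(4 * ?h\<^sup>2)\<^sup>2 \<le> (rat_height y)\<^sup>2" using y h by (intro power_mono) auto
      hence "16 * ?h ^ 4 \<le> (rat_height y)\<^sup>2" by (simp add: power_mult_distrib power_mult[symmetric])
      moreover have "?h ^ 3 \<le> ?h ^ 4" "?h ^ 3 > 0" using h by (auto intro: power_increasing)
      ultimately show False by linarith
    qed
    thus ?thesis using 1 y1 by (simp add: ratfun_eval_phi_Aff[OF t] del: ratfun_eval.simps)
  qed
  have orbit: "\<exists>y. (?f ^^ n) (Aff x) = Aff y \<and> rat_height y \<ge> 4 * ?h\<^sup>2" for n
  proof (induction n)
    case (Suc n)
    then obtain y where "(?f ^^ n) (Aff x) = Aff y" "rat_height y \<ge> 4 * ?h\<^sup>2" by blast
    thus ?case using step[of y] by (auto simp del: ratfun_eval.simps)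
  qed (use x in auto)
  have "(?f ^^ n) (Aff x) \<notin> integer_points" if n: "n > 0" for n
  proof -
    obtain k where k: "n = Suc k" using n gr0_implies_Suc by blast
    obtain y where "(?f ^^ k) (Aff x) = Aff y" "rat_height y \<ge> 4 * ?h\<^sup>2" using orbit by blast
    thus ?thesis using step[of y] k by (auto simp: integer_points_def simp del: ratfun_eval.simps)
  qed
  thus ?thesis unfolding forward_orbit_def by (auto simp del: ratfun_eval.simps)
    (metis funpow_0 neq0_conv)
qed

section \<open>Heights of values of rational functions\<close>

text \<open>One \<open>N\<close> clears the denominators of the homogenization in every degree
  \<open>n\<close> from the degree of \<open>p\<close> upwards. The freedom in \<open>n\<close>
  serves twice: the induction step passes from \<open>n\<close> to its predecessor, and later two
  polynomials of different degree are homogenized in the same degree.\<close>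

lemma ex_common_denominator:
  fixes p :: "rat poly"
  shows "\<exists>N::int. N > 0 \<and> (\<forall>n u v. degree p \<le> n \<longrightarrow> v \<noteq> 0 \<longrightarrow>
     of_int N * of_int v ^ n * poly p (of_int u / of_int v) \<in> \<int>)"
proof (induction p)
  case 0
  show ?case by (intro exI[of _ 1]) auto
next
  case (pCons a p)
  from pCons.IH obtain N :: int where "N > 0 \<and> (\<forall>n u v. degree p \<le> n \<longrightarrow> v \<noteq> 0 \<longrightarrow>
     of_int N * of_int v ^ n * poly p (of_int u / of_int v) \<in> \<int>)" ..
  hence N: "N > 0" "\<And>n u v. degree p \<le> n \<Longrightarrow> v \<noteq> 0 \<Longrightarrow>
     of_int N * of_int v ^ n * poly p (of_int u / of_int v) \<in> \<int>" by simp_all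
  obtain k l where a: "quotient_of a = (k, l)" by fastforce
  hence l: "l > 0" and a': "a = of_int k / of_int l"
    using quotient_of_div quotient_of_denom_pos by blast+
  show ?case
  proof (intro exI[of _ "N * l"] conjI allI impI)
    show "N * l > 0" using N l by simp
    fix n :: nat and u v :: int assume n: "degree (pCons a p) \<le> n" and v: "v \<noteq> 0"
    have 1: "of_int (N * l) * of_int v ^ n * a \<in> \<int>"
      using l by (simp add: a')
    show "of_int (N * l) * of_int v ^ n * poly (pCons a p) (of_int u / of_int v) \<in> \<int>"
    proof (cases "p = 0")
      case False
      then obtain m where m: "n = Suc m" "degree p \<le> m" using n by (cases n) auto
      define x :: rat where "x = of_int u / of_int v"
      have x: "of_int v * x = of_int u" using v by (simp add: x_def)
      have "of_int (N * l) * of_int v ^ n * poly (pCons a p) x =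
         of_int (N * l) * of_int v ^ n * a +
         (of_int l * (of_int v * x)) * (of_int N * of_int v ^ m * poly p x)"
        by (simp add: m algebra_simps)
      also have "\<dots> \<in> \<int>" unfolding x using 1 N(2)[OF m(2) v, of u, folded x_def]
        by (intro Ints_add Ints_mult[OF Ints_mult[OF Ints_of_int Ints_of_int]])
      finally show ?thesis unfolding x_def .
    qed (use 1 in simp)
  qed
qed

text \<open>The factor max 1 |x| is the archimedean part of the height: for x = u/v in lowest terms
  with v > 0, H(x) = v * max 1 |x|.\<close>

lemma abs_poly_upper:
  fixes p :: "'a::linordered_field poly"
  shows "\<exists>M>0. \<forall>n x. degree p \<le> n \<longrightarrow> \<bar>poly p x\<bar> \<le> M * max 1 \<bar>x\<bar> ^ n"
proof (induction p)
  case 0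
  show ?case by (intro exI[of _ 1]) auto
next
  case (pCons a p)
  then obtain M where M: "M > 0" "\<And>n x. degree p \<le> n \<Longrightarrow> \<bar>poly p x\<bar> \<le> M * max 1 \<bar>x\<bar> ^ n"
    by blast
  show ?case
  proof (intro exI[of _ "M + \<bar>a\<bar>"] conjI allI impI)
    show "M + \<bar>a\<bar> > 0" using M by linarith
    fix n x assume n: "degree (pCons a p) \<le> n"
    have 1: "\<bar>a\<bar> * 1 \<le> \<bar>a\<bar> * max 1 \<bar>x\<bar> ^ n" by (intro mult_left_mono one_le_power) auto
    show "\<bar>poly (pCons a p) x\<bar> \<le> (M + \<bar>a\<bar>) * max 1 \<bar>x\<bar> ^ n"
    proof (cases "p = 0")
      case True
      have "0 \<le> M * max 1 \<bar>x\<bar> ^ n" using M by auto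
      thus ?thesis using 1 True by (simp add: algebra_simps)
    next
      case False
      then obtain m where m: "n = Suc m" "degree p \<le> m" using n by (cases n) auto
      have "\<bar>poly (pCons a p) x\<bar> \<le> \<bar>a\<bar> + \<bar>x\<bar> * \<bar>poly p x\<bar>"
        using abs_triangle_ineq[of a "x * poly p x"] by (simp add: abs_mult)
      also have "\<bar>x\<bar> * \<bar>poly p x\<bar> \<le> max 1 \<bar>x\<bar> * (M * max 1 \<bar>x\<bar> ^ m)"
        using M(2)[OF m(2)] by (intro mult_mono) auto
      finally show ?thesis using 1 by (simp add: m algebra_simps)
    qed
  qed
qed

lemma degree_diff_lead_monom:
  fixes p :: "'a::idom poly"
  assumes "degree p > 0"
  shows "degree (p - monom (lead_coeff p) (degree p)) \<le> degree p - 1"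
proof (rule degree_le, intro allI impI)
  fix i assume "degree p - 1 < i"
  hence "i = degree p \<or> i > degree p" using assms by auto
  thus "coeff (p - monom (lead_coeff p) (degree p)) i = 0" by (auto simp: coeff_eq_0)
qed

text \<open>A Bezout identity bounds the larger of the two values from below on bounded sets; near
  infinity the leading term of \<open>p\<close> does.\<close>

lemma coprime_poly_values_lower:
  fixes p q :: "rat poly"
  assumes cop: "coprime p q" and deg: "degree q \<le> degree p" "degree p > 0"
  shows "\<exists>c>0. \<forall>x. c * max 1 \<bar>x\<bar> ^ degree p \<le> max \<bar>poly p x\<bar> \<bar>poly q x\<bar>"
proof -
  define d where "d = degree p"
  define l where "l = \<bar>lead_coeff p\<bar>"
  have l: "l > 0" using deg by (auto simp: l_def)
  obtain r s where rs: "r * p + s * q = 1"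
    using cop by (metis bezout_coefficients_fst_snd coprime_imp_gcd_eq_1)
  define p1 where "p1 = p - monom (lead_coeff p) d"
  have p1: "degree p1 \<le> d - 1" using degree_diff_lead_monom[OF deg(2)] by (simp add: p1_def d_def)
  obtain M1 where M1: "M1 > 0" "\<And>n x. degree r \<le> n \<Longrightarrow> \<bar>poly r x\<bar> \<le> M1 * max 1 \<bar>x\<bar> ^ n"
    using abs_poly_upper[of r] by blast
  obtain M2 where M2: "M2 > 0" "\<And>n x. degree s \<le> n \<Longrightarrow> \<bar>poly s x\<bar> \<le> M2 * max 1 \<bar>x\<bar> ^ n"
    using abs_poly_upper[of s] by blast
  obtain M3 where M3: "M3 > 0" "\<And>n x. degree p1 \<le> n \<Longrightarrow> \<bar>poly p1 x\<bar> \<le> M3 * max 1 \<bar>x\<bar> ^ n"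
    using abs_poly_upper[of p1] by blast
  define k where "k = max (degree r) (degree s)"
  \<comment> \<open>Beyond \<open>T\<close> the lower-order part \<open>p1\<close> is at most half
    of the leading term. Up to \<open>T\<close> the Bezout identity bounds the maximum below by 1 /
    ((M1 + M2) T^k), and the further T^d in \<open>e\<close> pays for the power of max 1
    |x|.\<close>
  define T where "T = max 1 (2 * M3 / l)"
  define e where "e = 1 / ((M1 + M2) * T ^ (k + d))"
  have T: "T \<ge> 1" by (simp add: T_def)
  have e: "e > 0" using M1 M2 T by (simp add: e_def)
  show ?thesis
  proof (intro exI[of _ "min e (l / 2)"] conjI allI)
    show "min e (l / 2) > 0" using e l by simp
    fix x
    let ?X = "max 1 \<bar>x\<bar>" and ?m = "max \<bar>poly p x\<bar> \<bar>poly q x\<bar>"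
    have X: "?X \<ge> 1" by simp
    show "min e (l / 2) * ?X ^ degree p \<le> ?m"
    proof (cases "?X \<le> T")
      case True
      have "1 = poly (r * p + s * q) x" by (simp add: rs)
      also have "\<dots> \<le> \<bar>poly r x\<bar> * \<bar>poly p x\<bar> + \<bar>poly s x\<bar> * \<bar>poly q x\<bar>"
        by (simp add: abs_mult[symmetric])
      also have "\<dots> \<le> (M1 * ?X ^ k) * ?m + (M2 * ?X ^ k) * ?m"
        using M1 M2 by (intro add_mono mult_mono) (auto simp: k_def)
      also have "\<dots> = (M1 + M2) * ?X ^ k * ?m" by (simp add: algebra_simps)
      also have "\<dots> \<le> (M1 + M2) * T ^ k * ?m"
        using M1 M2 True by (intro mult_right_mono mult_left_mono power_mono) auto
      finally have 1: "1 \<le> (M1 + M2) * T ^ k * ?m" .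
      have "min e (l / 2) * ?X ^ d \<le> e * T ^ d"
        using e True by (intro mult_mono power_mono) auto
      also have "\<dots> = 1 / ((M1 + M2) * T ^ k)" using T by (simp add: e_def power_add)
      also have "\<dots> \<le> ?m" using 1 M1 M2 T by (simp add: field_simps add_pos_pos)
      finally show ?thesis by (simp add: d_def)
    next
      case False
      hence X: "?X = \<bar>x\<bar>" "\<bar>x\<bar> \<ge> 1" "2 * M3 / l < \<bar>x\<bar>" using T by (auto simp: T_def max_def split: if_splits)
      obtain d' where d': "d = Suc d'" using deg by (auto simp: d_def dest: gr0_implies_Suc)
      have "poly p x = lead_coeff p * x ^ d + poly p1 x" by (simp add: p1_def poly_monom)
      moreover have "\<bar>lead_coeff p * x ^ d\<bar> = l * \<bar>x\<bar> ^ d" by (simp add: l_def abs_mult power_abs)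
      moreover have "\<bar>poly p1 x\<bar> \<le> M3 * \<bar>x\<bar> ^ d'" using M3(2)[of d' x] p1 X by (simp add: d')
      moreover have "M3 * \<bar>x\<bar> ^ d' \<le> (l / 2 * \<bar>x\<bar>) * \<bar>x\<bar> ^ d'"
        using X l by (intro mult_right_mono) (auto simp: field_simps)
      ultimately have "l / 2 * \<bar>x\<bar> ^ d \<le> \<bar>poly p x\<bar>"
        using abs_triangle_ineq2[of "lead_coeff p * x ^ d" "- poly p1 x"] by (simp add: d')
      moreover have "min e (l / 2) * \<bar>x\<bar> ^ d \<le> l / 2 * \<bar>x\<bar> ^ d" by (intro mult_right_mono) auto
      ultimately show ?thesis unfolding X(1) d_def by linarith
    qed
  qed
qed

text \<open>Write \<open>P\<close>, \<open>Q\<close> for the two integers in the conclusion. A Bezout identity shows that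
  \<open>gcd P Q\<close> divides a constant times $v^k$; modulo \<open>P\<close>, the leading term $N l u^d$ of the form
  is divisible by \<open>v\<close>, and \<open>u\<close>, \<open>v\<close> are coprime.\<close>

lemma coprime_forms_gcd_dvd:
  fixes p q :: "rat poly"
  assumes cop: "coprime p q" and deg: "degree q \<le> degree p" "degree p > 0"
  shows "\<exists>(N::int) (G::int). N > 0 \<and> G > 0 \<and> (\<forall>u v. coprime u v \<longrightarrow> v \<noteq> 0 \<longrightarrow>
     (\<exists>P Q. of_int P = of_int N * of_int v ^ degree p * poly p (of_int u / of_int v) \<and>
            of_int Q = of_int N * of_int v ^ degree p * poly q (of_int u / of_int v) \<and>
            gcd P Q dvd G))"
proof -
  define d where "d = degree p"
  obtain d' where d': "d = Suc d'" using deg by (auto simp: d_def dest: gr0_implies_Suc)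
  define l where "l = lead_coeff p"
  have l: "l \<noteq> 0" using deg by (auto simp: l_def)
  obtain r s where rs: "r * p + s * q = 1"
    using cop by (metis bezout_coefficients_fst_snd coprime_imp_gcd_eq_1)
  define p1 where "p1 = p - monom l d"
  have p1: "degree p1 \<le> d'" using degree_diff_lead_monom[OF deg(2)]
    by (simp add: p1_def d_def[symmetric] l_def d')
  \<comment> \<open>Integrality survives multiplying \<open>N\<close> by an integer, so a product of
    individual denominators serves several polynomials at once.\<close>
  define I where "I = (\<lambda>p (N::int). \<forall>n u v. degree p \<le> n \<longrightarrow> v \<noteq> 0 \<longrightarrow>
     of_int N * of_int v ^ n * poly p (of_int u / of_int v :: rat) \<in> \<int>)"
  have I_mult: "I p (M * N)" if "I p N" for p M N
    unfolding I_def
  proof (intro allI impI)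
    fix n u v assume "degree p \<le> n" "v \<noteq> (0::int)"
    hence "of_int M * (of_int N * of_int v ^ n * poly p (of_int u / of_int v :: rat)) \<in> \<int>"
      using that unfolding I_def by (intro Ints_mult[OF Ints_of_int]) blast
    thus "of_int (M * N) * of_int v ^ n * poly p (of_int u / of_int v :: rat) \<in> \<int>"
      by (simp add: mult.assoc)
  qed
  have ex: "\<exists>N>0. I p N" for p unfolding I_def using ex_common_denominator[of p] by blast
  obtain D where D: "\<And>p. D p > 0" "\<And>p. I p (D p)" using ex by metis
  define N where "N = D p * D q * D p1 * D [:l:]"
  define R where "R = D r * D s"
  have N: "N > 0" "I p N" "I q N" "I p1 N" "I [:l:] N" and R: "R > 0" "I r R" "I s R"
    using D I_mult[OF D(2), of p "D q * D p1 * D [:l:]"] I_mult[OF D(2), of q "D p * D p1 * D [:l:]"]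
      I_mult[OF D(2), of p1 "D p * D q * D [:l:]"] I_mult[OF D(2), of "[:l:]" "D p * D q * D p1"]
      I_mult[OF D(2), of r "D s"] I_mult[OF D(2), of s "D r"]
    by (simp_all add: N_def R_def mult_ac)
  have "of_int N * l \<in> \<int>" using N(5)[unfolded I_def, rule_format, of 0 1] by simp
  then obtain L where L: "of_int N * l = of_int L" by (auto elim: Ints_cases)
  have L0: "L \<noteq> 0" using L N(1) l by (metis less_irrefl mult_eq_0_iff of_int_0_eq_iff)
  define k where "k = max (degree r) (degree s)"
  \<comment> \<open>The Bezout identity is scaled by N v^d for \<open>p\<close>, \<open>q\<close>
    and by R v^k for \<open>r\<close>, \<open>s\<close>, hence by v^(d+k) in all.\<close>
  define e where "e = d + k"
  have "\<exists>P Q. of_int P = of_int N * of_int v ^ d * poly p (of_int u / of_int v) \<and>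
            of_int Q = of_int N * of_int v ^ d * poly q (of_int u / of_int v) \<and>
            gcd P Q dvd \<bar>N * R * L ^ e\<bar>" if uv: "coprime u v" "v \<noteq> 0" for u v
  proof -
    let ?t = "of_int u / of_int v :: rat"
    obtain P where P: "of_int P = of_int N * of_int v ^ d * poly p ?t"
      using N(2) uv(2) unfolding I_def d_def by (metis Ints_cases order_refl)
    obtain Q where Q: "of_int Q = of_int N * of_int v ^ d * poly q ?t"
      using N(3) uv(2) deg(1) unfolding I_def d_def by (metis Ints_cases)
    obtain P1 where P1: "of_int P1 = of_int N * of_int v ^ d' * poly p1 ?t"
      using N(4) uv(2) p1 unfolding I_def by (metis Ints_cases)
    obtain r' where r': "of_int r' = of_int R * of_int v ^ k * poly r ?t"
      using R(2) uv(2) unfolding I_def k_def by (metis Ints_cases max.cobounded1)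
    obtain s' where s': "of_int s' = of_int R * of_int v ^ k * poly s ?t"
      using R(3) uv(2) unfolding I_def k_def by (metis Ints_cases max.cobounded2)
    define g where "g = gcd P Q"
    have gPQ: "g dvd P" "g dvd Q" by (auto simp: g_def)
    have "poly r ?t * poly p ?t + poly s ?t * poly q ?t = 1"
      using arg_cong[OF rs, of "\<lambda>p. poly p ?t"] by simp
    hence "(of_int N * of_int R * of_int v ^ e) * (poly r ?t * poly p ?t + poly s ?t * poly q ?t) =
        (of_int (N * R * v ^ e) :: rat)" by simp
    hence "(of_int (r' * P + s' * Q) :: rat) = of_int (N * R * v ^ e)"
      by (simp add: r' s' P Q e_def power_add algebra_simps)
    hence "r' * P + s' * Q = N * R * v ^ e" by (simp only: of_int_eq_iff)
    moreover have "g dvd r' * P + s' * Q" using gPQ by auto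
    ultimately have g1: "g dvd N * R * v ^ e" by simp
    have "poly p ?t = l * ?t ^ d + poly p1 ?t" by (simp add: p1_def poly_monom)
    hence "(of_int P :: rat) = of_int (L * u ^ d + v * P1)"
      using uv(2) by (simp add: P P1 L[symmetric] d' field_simps)
    hence PL: "L * u ^ d = P - v * P1" by (simp only: of_int_eq_iff)
    \<comment> \<open>Modulo P the leading term L u^d is -v P1. Its e-th power therefore contains
      v^e, and \<open>g1\<close> applies.\<close>
    have "g dvd N * R * (L * u ^ d) ^ e"
    proof -
      have "(L * u ^ d) - (- (v * P1)) dvd (L * u ^ d) ^ e - (- (v * P1)) ^ e"
        by (metis dvd_triv_left power_diff_sumr2)
      hence "P dvd (L * u ^ d) ^ e - (- (v * P1)) ^ e" by (simp add: PL)
      hence "g dvd N * R * ((L * u ^ d) ^ e - (- (v * P1)) ^ e)"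
        using gPQ(1) by (intro dvd_mult) (rule dvd_trans)
      moreover have "N * R * (- (v * P1)) ^ e = (N * R * v ^ e) * (- P1) ^ e"
        by (simp add: power_mult_distrib flip: mult_minus_right)
      hence "g dvd N * R * (- (v * P1)) ^ e" using dvd_mult2[OF g1] by metis
      ultimately have "g dvd N * R * ((L * u ^ d) ^ e - (- (v * P1)) ^ e) + N * R * (- (v * P1)) ^ e"
        by (rule dvd_add)
      thus ?thesis by (simp add: right_diff_distrib)
    qed
    hence "g dvd N * R * L ^ e * u ^ (d * e)" by (simp add: power_mult_distrib power_mult mult.assoc)
    moreover have "g dvd N * R * L ^ e * v ^ e" using dvd_mult2[OF g1, of "L ^ e"] by (simp add: mult_ac)
    ultimately have "g dvd gcd (N * R * L ^ e * u ^ (d * e)) (N * R * L ^ e * v ^ e)" by (rule gcd_greatest)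
    also have "\<dots> = \<bar>N * R * L ^ e\<bar> * gcd (u ^ (d * e)) (v ^ e)" by (rule gcd_mult_distrib_int[symmetric])
    also have "gcd (u ^ (d * e)) (v ^ e) = 1" using uv(1) by (simp add: coprime_imp_gcd_eq_1)
    finally show ?thesis using P Q g_def by auto
  qed
  thus ?thesis using N(1) R(1) L0 unfolding d_def by (intro exI[of _ N] exI[of _ "\<bar>N * R * L ^ e\<bar>"]) auto
qed

text \<open>With P, Q from \<open>coprime_forms_gcd_dvd\<close>, gcd(P, Q) * H(p(t)/q(t)) is N v^d
  max(|p(t)|, |q(t)|), which is comparable to H(t)^d, and the gcd lies between 1 and G. If the value
  is an integer, then Q divides P, so |Q| equals the gcd and is at most G; this is the last clause,
  with k = Q.\<close>

lemma ratfun_height_bounds: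
  fixes p q :: "rat poly"
  assumes cop: "coprime p q" and deg: "max (degree p) (degree q) > 0"
  shows "\<exists>(c::real) (C::real) (N::int) (G::int). c > 0 \<and> C > 0 \<and> N > 0 \<and> G > 0 \<and>
    (\<forall>t. poly q t \<noteq> 0 \<longrightarrow>
      c * of_int (rat_height t) ^ max (degree p) (degree q) \<le> of_int (rat_height (poly p t / poly q t)) \<and>
      of_int (rat_height (poly p t / poly q t)) \<le> C * of_int (rat_height t) ^ max (degree p) (degree q) \<and>
      (poly p t / poly q t \<in> \<int> \<longrightarrow> (\<exists>k. k \<noteq> 0 \<and> \<bar>k\<bar> \<le> G \<and>
         of_int k = of_int N * of_int (snd (quotient_of t)) ^ max (degree p) (degree q) * poly q t)))"
proof -
  define d where "d = max (degree p) (degree q)"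
  obtain e where e: "e > 0" "\<And>x. e * max 1 \<bar>x\<bar> ^ d \<le> max \<bar>poly p x\<bar> \<bar>poly q x\<bar>"
  \<comment> \<open>The auxiliary lemmas want the polynomial of larger degree first. Passing to the
    reciprocal function exchanges p and q and changes neither the maximum nor the gcd.\<close>
  proof (cases "degree q \<le> degree p")
    case True
    thus ?thesis using that coprime_poly_values_lower[OF cop] deg by (auto simp: d_def)
  next
    case False
    thus ?thesis using that coprime_poly_values_lower[of q p] cop deg
      by (auto simp: d_def max.commute coprime_commute)
  qed
  obtain N G :: int where NG: "N > 0" "G > 0" "\<And>u v. coprime u v \<Longrightarrow> v \<noteq> 0 \<Longrightarrow>
     (\<exists>P Q. of_int P = of_int N * of_int v ^ d * poly p (of_int u / of_int v) \<and>
            of_int Q = of_int N * of_int v ^ d * poly q (of_int u / of_int v) \<and>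
            gcd P Q dvd G)"
  proof (cases "degree q \<le> degree p")
    case True
    hence "d = degree p" by (simp add: d_def)
    thus ?thesis using coprime_forms_gcd_dvd[OF cop True] deg that by (metis d_def)
  next
    case False
    hence "d = degree q" "degree p \<le> degree q" by (auto simp: d_def)
    thus ?thesis using coprime_forms_gcd_dvd[of q p] cop deg that
      by (metis d_def coprime_commute gcd.commute)
  qed
  obtain M1 where M1: "M1 > 0" "\<And>n x. degree p \<le> n \<Longrightarrow> \<bar>poly p x\<bar> \<le> M1 * max 1 \<bar>x\<bar> ^ n"
    using abs_poly_upper[of p] by blast
  obtain M2 where M2: "M2 > 0" "\<And>n x. degree q \<le> n \<Longrightarrow> \<bar>poly q x\<bar> \<le> M2 * max 1 \<bar>x\<bar> ^ n"
    using abs_poly_upper[of q] by blast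
  define M where "M = max M1 M2"
  have "e * of_int N / of_int G * of_int (rat_height t) ^ d \<le> of_int (rat_height (poly p t / poly q t)) \<and>
      of_int (rat_height (poly p t / poly q t)) \<le> M * of_int N * of_int (rat_height t) ^ d \<and>
      (poly p t / poly q t \<in> \<int> \<longrightarrow> (\<exists>k. k \<noteq> 0 \<and> \<bar>k\<bar> \<le> G \<and>
         of_int k = of_int N * of_int (snd (quotient_of t)) ^ d * poly q t))"
    if q: "poly q t \<noteq> 0" for t
  proof -
    obtain u v where uv: "quotient_of t = (u, v)" by fastforce
    have v: "v > 0" and t: "t = of_int u / of_int v" and cuv: "coprime u v"
      using uv quotient_of_denom_pos quotient_of_div quotient_of_coprime by blast+
    obtain P Q where P: "of_int P = of_int N * of_int v ^ d * poly p t"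
      and Q: "of_int Q = of_int N * of_int v ^ d * poly q t" and g: "gcd P Q dvd G"
      using NG(3)[OF cuv] v t by auto
    have "(of_int Q :: rat) \<noteq> 0" unfolding Q using NG(1) v q by simp
    hence Q0: "Q \<noteq> 0" by simp
    have g1: "1 \<le> gcd P Q" "gcd P Q \<le> G" using g NG(2) Q0
      by (auto simp: zdvd_imp_le int_one_le_iff_zero_less)
    have beta: "poly p t / poly q t = of_int P / of_int Q" unfolding P Q using NG(1) v by simp
    define h where "h = rat_height (poly p t / poly q t)"
    have h1: "h \<ge> 1" by (simp add: h_def rat_height_ge_1)
    have gh: "gcd P Q * h = max \<bar>P\<bar> \<bar>Q\<bar>" unfolding h_def beta by (rule rat_height_of_int_divide[OF Q0])
    let ?m = "max \<bar>poly p t\<bar> \<bar>poly q t\<bar>" and ?X = "max 1 \<bar>t\<bar>"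
    have "of_int (rat_height t) = (of_int v * ?X :: rat)"
      using v unfolding rat_height_def uv
      by (simp add: max_mult_distrib_left t abs_divide max.commute)
    hence H: "(of_int (rat_height t) ^ d :: rat) = of_int v ^ d * ?X ^ d" by (simp add: power_mult_distrib)
    have "(of_int (max \<bar>P\<bar> \<bar>Q\<bar>) :: rat) = of_int N * of_int v ^ d * ?m"
      using NG(1) v by (simp add: of_int_max P Q abs_mult max_mult_distrib_left)
    hence m: "(of_int (gcd P Q * h) :: rat) = of_int N * of_int v ^ d * ?m" by (simp only: gh)
    have "e * of_int N * of_int (rat_height t) ^ d = of_int N * of_int v ^ d * (e * ?X ^ d)"
      by (simp add: H)
    also have "\<dots> \<le> of_int N * of_int v ^ d * ?m" using NG(1) v e(2) by (intro mult_left_mono) auto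
    also have "\<dots> = of_int (gcd P Q * h)" by (simp only: m)
    also have "\<dots> \<le> of_int (G * h)" using g1 h1 by (simp only: of_int_le_iff mult_right_mono)
    finally have 1: "e * of_int N / of_int G * of_int (rat_height t) ^ d \<le> of_int h"
      using NG(2) by (simp add: field_simps)
    have "\<bar>poly p t\<bar> \<le> M * ?X ^ d"
      by (rule order_trans[OF M1(2) mult_right_mono]) (auto simp: d_def M_def)
    moreover have "\<bar>poly q t\<bar> \<le> M * ?X ^ d"
      by (rule order_trans[OF M2(2) mult_right_mono]) (auto simp: d_def M_def)
    ultimately have "?m \<le> M * ?X ^ d" by simp
    hence "of_int N * of_int v ^ d * ?m \<le> of_int N * of_int v ^ d * (M * ?X ^ d)"
      using NG(1) v by (intro mult_left_mono) auto
    also have "\<dots> = M * of_int N * of_int (rat_height t) ^ d" by (simp add: H)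
    finally have 2: "of_int N * of_int v ^ d * ?m \<le> M * of_int N * of_int (rat_height t) ^ d" .
    have "(of_int h :: rat) \<le> of_int (gcd P Q * h)"
      using mult_right_mono[OF g1(1), of h] h1 by (simp only: of_int_le_iff) simp
    also note m
    also note 2
    finally have 2: "of_int h \<le> M * of_int N * of_int (rat_height t) ^ d" .
    have 3: "\<exists>k. k \<noteq> 0 \<and> \<bar>k\<bar> \<le> G \<and> of_int k = of_int N * of_int v ^ d * poly q t"
      if "poly p t / poly q t \<in> \<int>"
    proof -
      from that obtain k where "of_int P / of_int Q = (of_int k :: rat)"
        unfolding beta by (auto elim: Ints_cases)
      hence "(of_int P :: rat) = of_int (k * Q)" using Q0 by (simp add: field_simps)
      hence "P = k * Q" by (simp only: of_int_eq_iff)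
      hence "\<bar>Q\<bar> = gcd P Q" by simp
      thus ?thesis using Q Q0 g1 by auto
    qed
    show ?thesis using 1 2 3 by (simp add: uv h_def)
  qed
  note * = this
  show ?thesis unfolding d_def[symmetric]
  proof (rule exI[of _ "of_rat (e * of_int N / of_int G)"], rule exI[of _ "of_rat (M * of_int N)"],
      rule exI[of _ N], rule exI[of _ G], intro conjI allI impI)
    show "0 < (of_rat (e * of_int N / of_int G) :: real)" "0 < (of_rat (M * of_int N) :: real)"
      using e(1) NG(1,2) M1(1) by (simp_all add: M_def)
    fix t assume q: "poly q t \<noteq> 0"
    have "(of_rat (e * of_int N / of_int G * of_int (rat_height t) ^ d) :: real)
        \<le> of_rat (of_int (rat_height (poly p t / poly q t)))"
      using *[OF q] by (simp only: of_rat_less_eq)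
    thus "of_rat (e * of_int N / of_int G) * of_int (rat_height t) ^ d
        \<le> (of_int (rat_height (poly p t / poly q t)) :: real)"
      by (simp add: of_rat_mult of_rat_divide of_rat_power)
    have "(of_rat (of_int (rat_height (poly p t / poly q t))) :: real)
        \<le> of_rat (M * of_int N * of_int (rat_height t) ^ d)"
      using *[OF q] by (simp only: of_rat_less_eq)
    thus "(of_int (rat_height (poly p t / poly q t)) :: real)
        \<le> of_rat (M * of_int N) * of_int (rat_height t) ^ d"
      by (simp add: of_rat_mult of_rat_power)
    assume "poly p t / poly q t \<in> \<int>"
    thus "\<exists>k. k \<noteq> 0 \<and> \<bar>k\<bar> \<le> G \<and> of_int k = of_int N * of_int (snd (quotient_of t)) ^ d * poly q t"
      using *[OF q] by blast
  qed (use NG in auto)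
qed

section \<open>Counting integral values and all rationals of bounded height\<close>

text \<open>If $p/q$ takes an integer value at $t = u/v$, then $N v^d q(t)$ is one of finitely many
  integers, so \<open>v\<close> determines \<open>t\<close> up to boundedly many choices unless \<open>q\<close> is constant; in that case
  \<open>v\<close> itself is bounded.\<close>

lemma card_integer_values_le:
  fixes q :: "rat poly"
  assumes N: "N > 0" and q: "q \<noteq> 0" and d: "d > 0"
  shows "\<exists>K::nat. \<forall>n. card {t. rat_height t \<le> int n \<and> (\<exists>k. k \<noteq> 0 \<and> \<bar>k\<bar> \<le> G \<and>
      of_int k = of_int N * of_int (snd (quotient_of t)) ^ d * poly q t)} \<le> K * Suc n"
    (is "\<exists>K. \<forall>n. card (?S n) \<le> _")
proof (cases "degree q = 0")
  case False
  let ?R = "\<lambda>v k. {t. poly (q - [:of_int k / (of_int N * of_int v ^ d):]) t = 0}"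
  have R0: "q - [:x:] \<noteq> 0" for x using False by (metis degree_pCons_0 eq_iff_diff_eq_0)
  have R: "finite (?R v k)" "card (?R v k) \<le> degree q" for v k :: int
  proof -
    show "finite (?R v k)" using R0 by (rule poly_roots_finite)
    have "card (?R v k) \<le> degree (q - [:of_int k / (of_int N * of_int v ^ d):])"
      using R0 by (rule card_poly_roots_bound)
    also have "\<dots> \<le> degree q" by (rule order_trans[OF degree_diff_le_max]) simp
    finally show "card (?R v k) \<le> degree q" .
  qed
  have "card (?S n) \<le> (card {-G..G} * degree q) * Suc n" for n
  proof -
    have "?S n \<subseteq> (\<Union>v\<in>{1..int n}. \<Union>k\<in>{-G..G}. ?R v k)"
    proof
      fix t assume "t \<in> ?S n"
      then obtain k where t: "rat_height t \<le> int n" "\<bar>k\<bar> \<le> G"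
        "of_int k = of_int N * of_int (snd (quotient_of t)) ^ d * poly q t" by blast
      have v: "snd (quotient_of t) > 0" by (rule quotient_of_denom_pos')
      with t have "snd (quotient_of t) \<in> {1..int n}" "k \<in> {-G..G}"
        by (auto simp: rat_height_def)
      moreover have "t \<in> ?R (snd (quotient_of t)) k" using N v by (simp add: t(3))
      ultimately show "t \<in> (\<Union>v\<in>{1..int n}. \<Union>k\<in>{-G..G}. ?R v k)" by blast
    qed
    hence "card (?S n) \<le> card (\<Union>v\<in>{1..int n}. \<Union>k\<in>{-G..G}. ?R v k)"
      using R(1) by (intro card_mono) auto
    also have "\<dots> \<le> (\<Sum>v\<in>{1..int n}. card (\<Union>k\<in>{-G..G}. ?R v k))" by (intro card_UN_le) auto
    also have "\<dots> \<le> (\<Sum>v\<in>{1..int n}. \<Sum>k\<in>{-G..G}. card (?R v k))"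
      by (intro sum_mono card_UN_le) auto
    also have "\<dots> \<le> (\<Sum>v\<in>{1..int n}. \<Sum>k\<in>{-G..G}. degree q)" by (intro sum_mono R(2))
    also have "\<dots> \<le> (card {-G..G} * degree q) * Suc n" by simp
    finally show ?thesis .
  qed
  thus ?thesis by blast
next
  case True
  then obtain w where w: "q = [:w:]" "w \<noteq> 0" using q by (metis degree_eq_zeroE pCons_0_0)
  \<comment> \<open>For q = w constant the condition reads N v^d w = k, so v <= v^d <= G / (N |w|),
    and only the numerator still ranges up to n.\<close>
  define W where "W = \<lceil>of_int G / (of_int N * \<bar>w\<bar>)\<rceil>"
  have "card (?S n) \<le> (2 * card {1..W}) * Suc n" for n
  proof -
    have "?S n \<subseteq> (\<lambda>(u, v). of_int u / of_int v) ` ({-int n..int n} \<times> {1..W})"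
    proof
      fix t assume "t \<in> ?S n"
      then obtain k where t: "rat_height t \<le> int n" "\<bar>k\<bar> \<le> G"
        "of_int k = of_int N * of_int (snd (quotient_of t)) ^ d * poly q t" by blast
      obtain u v where uv: "quotient_of t = (u, v)" by fastforce
      have v: "v > 0" and tuv: "t = of_int u / of_int v"
        using uv quotient_of_denom_pos quotient_of_div by blast+
      have "of_int (v ^ d) * (of_int N * \<bar>w\<bar>) = of_int \<bar>k\<bar>"
        using N v t(3) by (simp add: uv w abs_mult)
      also have "\<dots> \<le> of_int G" using t(2) by (simp only: of_int_le_iff)
      finally have "of_int (v ^ d) \<le> of_int G / (of_int N * \<bar>w\<bar>)"
        using N w(2) by (subst pos_le_divide_eq) auto
      hence "v ^ d \<le> W" unfolding W_def using of_int_le_iff le_of_int_ceiling order_trans by blast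
      moreover have "v \<le> v ^ d" using v d by (intro self_le_power) auto
      ultimately have "v \<in> {1..W}" using v by auto
      moreover have "u \<in> {-int n..int n}" using t(1) by (auto simp: rat_height_def uv)
      ultimately show "t \<in> (\<lambda>(u, v). of_int u / of_int v) ` ({-int n..int n} \<times> {1..W})"
        unfolding tuv by force
    qed
    hence "card (?S n) \<le> card ({-int n..int n} \<times> {1..W})" by (rule surj_card_le[rotated]) simp
    also have "\<dots> = card {-int n..int n} * card {1..W}" by (rule card_cartesian_product)
    also have "\<dots> \<le> (2 * Suc n) * card {1..W}" by (intro mult_right_mono) auto
    finally show ?thesis by (simp add: mult_ac)
  qed
  thus ?thesis by blast
qed

text \<open>Count the fractions with denominator $2^j$ for $j < K$ and odd numerator.\<close>

lemma card_rat_height_le_lower: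
  fixes K n :: nat
  assumes "2 ^ K \<le> n"
  shows "K * (n div 2) \<le> card {t. rat_height t \<le> int n}"
proof -
  \<comment> \<open>An odd number over a power of 2 is already reduced, so injectivity and height
    can both be read off \<open>quotient_of\<close>.\<close>
  let ?f = "\<lambda>(i, j). of_int (2 * int i + 1) / of_int (2 ^ j) :: rat"
  have quot: "quotient_of (?f (i, j)) = (2 * int i + 1, 2 ^ j)" for i j
  proof -
    have "coprime (2 * int i + 1) (2 ^ j)" by simp
    from quotient_of_eqI[OF this] show ?thesis by simp
  qed
  have "inj_on ?f ({..<n div 2} \<times> {..<K})"
  proof (rule inj_onI)
    fix x y assume eq: "?f x = ?f y"
    obtain i j i' j' where xy: "x = (i, j)" "y = (i', j')" by fastforce
    have "quotient_of (?f (i, j)) = quotient_of (?f (i', j'))" using eq by (simp only: xy)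
    hence "(2 * int i + 1, 2 ^ j) = (2 * int i' + 1, 2 ^ j' :: int)" unfolding quot .
    thus "x = y" by (simp add: xy)
  qed
  hence "card ({..<n div 2} \<times> {..<K}) = card (?f ` ({..<n div 2} \<times> {..<K}))"
    by (rule card_image[symmetric])
  also have "\<dots> \<le> card {t. rat_height t \<le> int n}"
  proof (intro card_mono finite_rat_height_le image_subsetI)
    fix x assume "x \<in> {..<n div 2} \<times> {..<K}"
    then obtain i j where x: "x = (i, j)" "i < n div 2" "j < K" by auto
    have "(2::nat) ^ j \<le> 2 ^ K" using x by (intro power_increasing) auto
    hence "2 ^ j \<le> n" using assms by (rule order_trans)
    hence "(2::int) ^ j \<le> int n" by (metis of_nat_le_iff of_nat_numeral of_nat_power)
    moreover have "2 * int i + 1 \<le> int n" using x(2) by linarith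
    ultimately have "rat_height (?f (i, j)) \<le> int n" unfolding rat_height_def quot by simp
    thus "?f x \<in> {t. rat_height t \<le> int n}" by (simp only: x mem_Collect_eq)
  qed
  finally show ?thesis by (simp add: mult.commute)
qed

text \<open>Where Y is positive the quotient in \<open>ennreal\<close> is the image of the real
  quotient, which reduces the limit to real inequalities.\<close>

lemma Limsup_nat_ratio_eq_0:
  fixes X Y :: "'a \<Rightarrow> nat"
  assumes "\<And>\<epsilon>::real. \<epsilon> > 0 \<Longrightarrow> eventually (\<lambda>B. Y B > 0 \<and> real (X B) \<le> \<epsilon> * real (Y B)) F"
  shows "Limsup F (\<lambda>B. of_nat (X B) / of_nat (Y B) :: ennreal) = 0"
proof -
  have "Limsup F (\<lambda>B. of_nat (X B) / of_nat (Y B) :: ennreal) \<le> 0 + ennreal \<epsilon>" if "\<epsilon> > 0" for \<epsilon>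
  proof (intro Limsup_bounded eventually_mono[OF assms[OF that]])
    fix B assume *: "Y B > 0 \<and> real (X B) \<le> \<epsilon> * real (Y B)"
    hence "of_nat (X B) / of_nat (Y B) = ennreal (real (X B) / real (Y B))"
      by (simp add: ennreal_of_nat_eq_real_of_nat divide_ennreal)
    also have "\<dots> \<le> 0 + ennreal \<epsilon>" using * by (simp add: ennreal_leI pos_divide_le_eq)
    finally show "of_nat (X B) / of_nat (Y B) \<le> 0 + ennreal \<epsilon>" .
  qed
  thus ?thesis by (metis ennreal_le_epsilon le_zero_eq)
qed


section \<open>The density estimate\<close>

theorem theorem2p6:
  fixes \<beta> :: "rat poly fract"
  assumes "ratfun_degree \<beta> \<ge> 3"
  shows "Limsup at_top (\<lambda>B :: real.
           (\<Sum>t\<in>params \<beta> B.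
              emeasure (count_space UNIV)
                (forward_orbit (ratfun_eval (phi t)) (ratfun_eval \<beta> (Aff t)) \<inter> integer_points))
           / of_nat (card (params \<beta> B))) = (0 :: ennreal)"
proof -
  obtain p q where pq: "quot_of_fract \<beta> = (p, q)" by fastforce
  define d where "d = max (degree p) (degree q)"
  have d: "d \<ge> 3" using assms by (simp add: ratfun_degree_def pq d_def)
  have q0: "q \<noteq> 0" using snd_quot_of_fract_nonzero[of \<beta>] pq by simp
  have cop: "coprime p q" using coprime_quot_of_fract[of \<beta>] pq by simp
  have eval: "ratfun_eval \<beta> (Aff t) = (if poly q t = 0 then Infty else Aff (poly p t / poly q t))" for t
    by (simp add: pq)
  obtain c C :: real and N G :: int where cC: "c > 0" "C > 0" "N > 0" "G > 0" and
    *: "\<forall>t. poly q t \<noteq> 0 \<longrightarrow>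
      c * of_int (rat_height t) ^ d \<le> of_int (rat_height (poly p t / poly q t)) \<and>
      of_int (rat_height (poly p t / poly q t)) \<le> C * of_int (rat_height t) ^ d \<and>
      (poly p t / poly q t \<in> \<int> \<longrightarrow> (\<exists>k. k \<noteq> 0 \<and> \<bar>k\<bar> \<le> G \<and>
         of_int k = of_int N * of_int (snd (quotient_of t)) ^ d * poly q t))"
    using ratfun_height_bounds[OF cop] d unfolding d_def by fastforce
  have lower: "c * of_int (rat_height t) ^ d \<le> of_int (rat_height (poly p t / poly q t))"
    and upper: "of_int (rat_height (poly p t / poly q t)) \<le> C * of_int (rat_height t) ^ d"
    and integral: "poly p t / poly q t \<in> \<int> \<Longrightarrow> \<exists>k. k \<noteq> 0 \<and> \<bar>k\<bar> \<le> G \<and>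
         of_int k = of_int N * of_int (snd (quotient_of t)) ^ d * poly q t"
    if "poly q t \<noteq> 0" for t using * that by blast+
  define Z where "Z = {t. poly q t \<noteq> 0 \<and> poly p t / poly q t \<in> \<int>}"
  obtain K where K: "\<And>n. card {t. rat_height t \<le> int n \<and> (\<exists>k. k \<noteq> 0 \<and> \<bar>k\<bar> \<le> G \<and>
      of_int k = of_int N * of_int (snd (quotient_of t)) ^ d * poly q t)} \<le> K * Suc n"
    using card_integer_values_le[OF cC(3) q0, of d G] d by auto
  have KZ: "card {t \<in> Z. rat_height t \<le> int n} \<le> K * Suc n" for n
  proof (rule order_trans[OF card_mono K])
    show "{t \<in> Z. rat_height t \<le> int n} \<subseteq> {t. rat_height t \<le> int n \<and> (\<exists>k. k \<noteq> 0 \<and> \<bar>k\<bar> \<le> G \<and>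
      of_int k = of_int N * of_int (snd (quotient_of t)) ^ d * poly q t)}"
      using integral by (auto simp: Z_def)
  qed (rule finite_subset[OF _ finite_rat_height_le[of "int n"]], auto)
  define Orb where "Orb t = forward_orbit (ratfun_eval (phi t)) (ratfun_eval \<beta> (Aff t)) \<inter> integer_points" for t
  have finOrb: "finite (Orb t)" if "t \<noteq> -1" for t
    unfolding Orb_def using that by (rule finite_integer_orbit)
  \<comment> \<open>Exceptional parameters: poles of \<beta>, where the orbit starts at infinity,
    and t of small height. Once c H(t) >= 4, the assumption d >= 3 gives c H(t)^d >= 4 H(t)^2. Their
    total contribution is the constant \<open>S\<close>.\<close>
  define E where "E = {t. t \<noteq> -1 \<and> (poly q t = 0 \<or> rat_height t \<le> \<lceil>4 / c\<rceil>)}"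
  have finE: "finite E"
    by (rule finite_subset[OF _ finite_UnI[OF poly_roots_finite[OF q0] finite_rat_height_le[of "\<lceil>4 / c\<rceil>"]]])
      (auto simp: E_def)
  have Orb_le: "card (Orb t) \<le> (if t \<in> Z then 1 else 0)" if t: "t \<noteq> -1" "t \<notin> E" for t
  proof -
    have q: "poly q t \<noteq> 0" and h: "rat_height t > \<lceil>4 / c\<rceil>" using t by (auto simp: E_def)
    let ?h = "real_of_int (rat_height t)"
    have h1: "?h \<ge> 1" using rat_height_ge_1[of t] by simp
    have "4 / c < ?h" using h by linarith
    hence "4 \<le> c * ?h" using cC(1) by (simp add: field_simps)
    hence "4 * ?h ^ 2 \<le> (c * ?h) * ?h ^ 2" by (intro mult_right_mono) auto
    also have "\<dots> = c * ?h ^ 3" by (simp add: power_numeral_reduce)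
    also have "\<dots> \<le> c * ?h ^ d" using d h1 cC(1) by (intro mult_left_mono power_increasing) auto
    also have "\<dots> \<le> of_int (rat_height (poly p t / poly q t))" by (rule lower[OF q])
    finally have "real_of_int (4 * (rat_height t)\<^sup>2) \<le> of_int (rat_height (poly p t / poly q t))" by simp
    hence "4 * (rat_height t)\<^sup>2 \<le> rat_height (poly p t / poly q t)" by (simp only: of_int_le_iff)
    hence "Orb t \<subseteq> {Aff (poly p t / poly q t)}"
      using integer_orbit_subset[OF t(1)] q unfolding Orb_def eval by simp
    hence "Orb t \<subseteq> (if t \<in> Z then {Aff (poly p t / poly q t)} else {})"
      using q by (auto simp: Orb_def Z_def integer_points_def simp del: ratfun_eval.simps)
    from card_mono[OF _ this] show ?thesis by (auto split: if_splits)
  qed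
  define X where "X B = (\<Sum>t\<in>params \<beta> B. card (Orb t))" for B
  define Y where "Y B = card (params \<beta> B)" for B
  define S where "S = (\<Sum>t\<in>E. card (Orb t))"
  have finP: "finite (params \<beta> B)" for B using assms by (intro finite_params) auto
  have X_le: "X B \<le> S + card (params \<beta> B \<inter> Z)" for B
  proof -
    have "X B \<le> (\<Sum>t\<in>params \<beta> B. (if t \<in> E then card (Orb t) else 0) + (if t \<in> Z then 1 else 0))"
      unfolding X_def
    proof (rule sum_mono)
      fix t assume "t \<in> params \<beta> B"
      hence "t \<noteq> -1" by (simp add: params_def)
      thus "card (Orb t) \<le> (if t \<in> E then card (Orb t) else 0) + (if t \<in> Z then 1 else 0)"
        using Orb_le[of t] by (cases "t \<in> E") auto
    qed
    also have "\<dots> = (\<Sum>t\<in>params \<beta> B \<inter> E. card (Orb t)) + card (params \<beta> B \<inter> Z)"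
      using finP by (simp add: sum.distrib sum.inter_restrict[symmetric])
    also have "(\<Sum>t\<in>params \<beta> B \<inter> E. card (Orb t)) \<le> S"
      unfolding S_def using finE by (intro sum_mono2) auto
    finally show ?thesis by simp
  qed
  \<comment> \<open>Chosen so that c L^d >= C: then c H(t)^d <= exp B < C (n + 1)^d yields H(t) < L
    (n + 1).\<close>
  define L where "L = nat \<lceil>C / c\<rceil> + 1"
  have L1: "L \<ge> 1" by (simp add: L_def)
  \<comment> \<open>The largest natural number with C n^d <= exp B, so that H(t) <= n forces
    H(\<beta>(t)) <= exp B away from the poles.\<close>
  define n where "n B = nat \<lfloor>root d (exp B / C)\<rfloor>" for B
  have root0: "root d (exp B / C) \<ge> 0" for B using cC d by simp
  have n_le: "C * real (n B) ^ d \<le> exp B" for B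
  proof -
    have "real (n B) \<le> root d (exp B / C)" using root0[of B] by (simp add: n_def)
    hence "real (n B) ^ d \<le> root d (exp B / C) ^ d" by (intro power_mono) auto
    also have "\<dots> = exp B / C" using cC d by simp
    finally show ?thesis using cC by (simp add: field_simps)
  qed
  have n_gt: "exp B < C * real (Suc (n B)) ^ d" for B
  proof -
    have "root d (exp B / C) < real (Suc (n B))" using root0[of B] unfolding n_def by linarith
    hence "root d (exp B / C) ^ d < real (Suc (n B)) ^ d" using root0 d by (intro power_strict_mono) auto
    moreover have "root d (exp B / C) ^ d = exp B / C" using cC d by simp
    ultimately show ?thesis using cC by (simp add: field_simps)
  qed
  have weil_le: "weil_height (Aff x) \<le> B \<longleftrightarrow> real_of_int (rat_height x) \<le> exp B" for x B
  proof -
    have "0 < real_of_int (rat_height x)" using rat_height_ge_1[of x] by simp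
    thus ?thesis unfolding weil_height_Aff by (metis exp_le_cancel_iff exp_ln)
  qed
  have PZ: "card (params \<beta> B \<inter> Z) \<le> K * Suc (L * Suc (n B))" for B
  proof (rule order_trans[OF card_mono KZ])
    show "params \<beta> B \<inter> Z \<subseteq> {t \<in> Z. rat_height t \<le> int (L * Suc (n B))}"
    proof
      fix t assume t: "t \<in> params \<beta> B \<inter> Z"
      hence q: "poly q t \<noteq> 0" by (simp add: Z_def)
      have "C \<le> c * real L"
      proof -
        have "C / c \<le> real L" unfolding L_def by linarith
        thus ?thesis using cC by (simp add: field_simps)
      qed
      also have "\<dots> \<le> c * real L ^ d" using cC d L1 by (intro mult_left_mono self_le_power) auto
      finally have CL: "C \<le> c * real L ^ d" .
      have "c * of_int (rat_height t) ^ d \<le> of_int (rat_height (poly p t / poly q t))"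
        by (rule lower[OF q])
      also have "\<dots> \<le> exp B" using t q weil_le[of "poly p t / poly q t" B]
        by (simp add: params_def eval del: ratfun_eval.simps weil_height.simps)
      also have "\<dots> < C * real (Suc (n B)) ^ d" by (rule n_gt)
      also have "\<dots> \<le> (c * real L ^ d) * real (Suc (n B)) ^ d" using CL by (intro mult_right_mono) auto
      also have "\<dots> = c * real (L * Suc (n B)) ^ d" by (simp only: of_nat_mult power_mult_distrib mult.assoc)
      finally have "real_of_int (rat_height t) ^ d < real (L * Suc (n B)) ^ d" using cC(1) by simp
      hence "real_of_int (rat_height t) < real (L * Suc (n B))"
        by (rule power_less_imp_less_base) simp
      hence "rat_height t \<le> int (L * Suc (n B))" by linarith
      thus "t \<in> {t \<in> Z. rat_height t \<le> int (L * Suc (n B))}" using t by simp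
    qed
  qed (rule finite_subset[OF _ finite_rat_height_le[of "int (L * Suc (n B))"]], auto)
  \<comment> \<open>\<open>Suc\<close> accounts for t = -1, which is not a parameter; B >= 0 admits
    the poles of \<beta>, since infinity has height 0.\<close>
  have Y_ge: "card {t. rat_height t \<le> int (n B)} \<le> Suc (Y B)" if B: "B \<ge> 0" for B
  proof -
    have "{t. rat_height t \<le> int (n B)} \<subseteq> insert (-1) (params \<beta> B)"
    proof
      fix t assume "t \<in> {t. rat_height t \<le> int (n B)}"
      hence t: "rat_height t \<le> int (n B)" by simp
      show "t \<in> insert (-1) (params \<beta> B)"
      proof (cases "poly q t = 0")
        case False
        have "of_int (rat_height (poly p t / poly q t)) \<le> C * of_int (rat_height t) ^ d"
          by (rule upper[OF False])
        also have "\<dots> \<le> C * real (n B) ^ d"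
          using cC t rat_height_ge_1[of t] by (intro mult_left_mono power_mono) auto
        also have "\<dots> \<le> exp B" by (rule n_le)
        finally show ?thesis using False weil_le[of "poly p t / poly q t" B]
          by (simp add: params_def eval del: ratfun_eval.simps weil_height.simps)
      qed (use B in \<open>simp add: params_def eval del: ratfun_eval.simps\<close>)
    qed
    hence "card {t. rat_height t \<le> int (n B)} \<le> card (insert (-1) (params \<beta> B))"
      using finP by (intro card_mono) auto
    also have "\<dots> \<le> Suc (Y B)" unfolding Y_def by (simp add: card_insert_if finP)
    finally show ?thesis .
  qed
  have n_at_top: "eventually (\<lambda>B. n B \<ge> k) at_top" for k
  proof -
    have "eventually (\<lambda>B. exp B \<ge> C * real k ^ d) at_top"
      using exp_at_top by (simp add: filterlim_at_top)
    thus ?thesis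
    proof eventually_elim
      case (elim B)
      show ?case
      proof (rule ccontr)
        assume "\<not> n B \<ge> k"
        hence "C * real (Suc (n B)) ^ d \<le> C * real k ^ d"
          using cC by (intro mult_left_mono power_mono) auto
        with n_gt[of B] elim show False by linarith
      qed
    qed
  qed
  have "Limsup at_top (\<lambda>B. of_nat (X B) / of_nat (Y B) :: ennreal) = 0"
  proof (rule Limsup_nat_ratio_eq_0)
    fix \<epsilon> :: real assume \<epsilon>: "\<epsilon> > 0"
    \<comment> \<open>For n >= 2 one gets X <= A n. The choice of \<open>m\<close> gives Y + 1 >= m
      (n div 2) >= m n / 3 >= (A/\<epsilon> + 2) n, where the 2n absorbs the 1 and keeps Y
      positive.\<close>
    define A where "A = real (S + 3 * K * L)"
    define m where "m = nat \<lceil>3 * (A / \<epsilon> + 2)\<rceil>"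
    have m: "real m \<ge> 3 * (A / \<epsilon> + 2)" unfolding m_def by (rule real_nat_ceiling_ge)
    have "eventually (\<lambda>B. n B \<ge> max 2 (2 ^ m)) at_top"
      by (rule n_at_top)
    thus "eventually (\<lambda>B. Y B > 0 \<and> real (X B) \<le> \<epsilon> * real (Y B)) at_top"
      using eventually_ge_at_top[of 0]
    proof eventually_elim
      case (elim B)
      have n2: "n B \<ge> 2" using elim by simp
      have "m * (n B div 2) \<le> Suc (Y B)"
        using card_rat_height_le_lower[of m "n B"] Y_ge[of B] elim by simp
      hence "real m * real (n B div 2) \<le> real (Y B) + 1"
        by (metis of_nat_Suc of_nat_le_iff of_nat_mult add.commute)
      moreover have "n B \<le> 3 * (n B div 2)" using n2 by presburger
      hence "real (n B) / 3 \<le> real (n B div 2)" by linarith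
      hence "real m * (real (n B) / 3) \<le> real m * real (n B div 2)" by (rule mult_left_mono) simp
      moreover have "3 * (A / \<epsilon> + 2) * (real (n B) / 3) \<le> real m * (real (n B) / 3)"
        using m by (intro mult_right_mono) auto
      ultimately have "3 * (A / \<epsilon> + 2) * (real (n B) / 3) \<le> real (Y B) + 1"
        by (meson order_trans)
      moreover have "3 * (A / \<epsilon> + 2) * (real (n B) / 3) = A / \<epsilon> * real (n B) + 2 * real (n B)"
        by (simp add: distrib_right)
      ultimately have Y: "A / \<epsilon> * real (n B) + 2 * real (n B) \<le> real (Y B) + 1" by linarith
      have "X B \<le> S + K * Suc (L * Suc (n B))" using X_le[of B] PZ[of B] by linarith
      also have "\<dots> \<le> S * n B + K * (3 * L * n B)"
      proof (intro add_mono mult_left_mono)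
        show "S \<le> S * n B" using n2 by simp
        have "Suc (n B) \<le> 2 * n B" using n2 by simp
        hence "L * Suc (n B) \<le> 2 * (L * n B)" by (metis mult.left_commute mult_le_mono2)
        moreover have "1 * 1 \<le> L * n B" using L1 n2 by (intro mult_mono) auto
        ultimately show "Suc (L * Suc (n B)) \<le> 3 * L * n B" unfolding mult.assoc by linarith
      qed auto
      also have "\<dots> = (S + 3 * K * L) * n B" by (simp add: algebra_simps)
      finally have "real (X B) \<le> A * real (n B)" unfolding A_def by (metis of_nat_le_iff of_nat_mult)
      also have "\<dots> = \<epsilon> * (A / \<epsilon> * real (n B))" using \<epsilon> by simp
      also have "\<dots> \<le> \<epsilon> * real (Y B)" using Y n2 \<epsilon> by (intro mult_left_mono) auto
      finally have "real (X B) \<le> \<epsilon> * real (Y B)" .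
      moreover have "A / \<epsilon> * real (n B) \<ge> 0" using \<epsilon> by (simp add: A_def)
      hence "real (Y B) > 0" using Y n2 by linarith
      ultimately show ?case by simp
    qed
  qed
  moreover have "(\<Sum>t\<in>params \<beta> B. emeasure (count_space UNIV) (Orb t)) = of_nat (X B)" for B
    unfolding X_def of_nat_sum
    by (intro sum.cong refl emeasure_count_space_finite) (auto simp: params_def intro: finOrb)
  ultimately show ?thesis by (simp add: Orb_def Y_def del: ratfun_eval.simps)
qed

end
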